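(* Let $k\ge 1$ and $r\geq 1$ be integers. For every integer $n\ge 1$, the $r$-times iterated binomial transform $\{b_{k,n}^{(r)}\}_{n\ge 0}$ of the $k$-Lucas sequence satisfies $$\sum_{i=0}^{n-1}b_{k,i}^{(r)}=\frac{(r^{2}+kr-1)\,b_{k,n-1}^{(r)}-b_{k,n}^{(r)}-k-2r+2}{r^{2}+kr-k-2r}.$$
   Context: The $k$-Lucas sequence $\{L_{k,n}\}_{n\ge 0}$ is defined by $L_{k,0}=2$, $L_{k,1}=k$ and $L_{k,n+1}=kL_{k,n}+L_{k,n-1}$ for $n\ge 1$. The binomial transform of a sequence $\{x_0,x_1,x_2,\ldots\}$ is the sequence $\{b_n\}$ with $b_n=\sum_{i=0}^{n}\binom{n}{i}x_i$. The sequence $\{b_{k,n}^{(r)}\}_{n\ge 0}$ is obtained by applying the binomial transform $r$ times to the $k$-Lucas sequence, i.e. $b_{k,n}^{(0)}=L_{k,n}$ and $b_{k,n}^{(r)}=\sum_{i=0}^{n}\binom{n}{i}b_{k,i}^{(r-1)}$ for $r\ge 1$. The identity is between rational numbers. *)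

theory Defs
  imports Complex_Main
begin

fun k_lucas :: "int \<Rightarrow> nat \<Rightarrow> int" where
  "k_lucas k 0 = 2"
| "k_lucas k (Suc 0) = k"
| "k_lucas k (Suc (Suc n)) = k * k_lucas k (Suc n) + k_lucas k n"

definition binomial_transform :: "(nat \<Rightarrow> int) \<Rightarrow> nat \<Rightarrow> int" where
  "binomial_transform x n = (\<Sum>i=0..n. int (n choose i) * x i)"

definition iter_binomial_lucas :: "int \<Rightarrow> nat \<Rightarrow> nat \<Rightarrow> int" where
  "iter_binomial_lucas k r = (binomial_transform ^^ r) (k_lucas k)"

end

theory Submission
  imports Defs
begin

text \<open>
  The binomial transform conjugates the shift operator \<open>S\<close> into \<open>S - 1\<close>: by Pascal's rule,
  transforming the shifted sequence gives the difference sequence of the transform.  A sequence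
  annihilated by the polynomial \<open>f(S) = S\<^sup>2 - p S + q\<close> is therefore mapped to one annihilated by
  \<open>f(S - 1) = S\<^sup>2 - (p + 2) S + (q + p + 1)\<close>.  The \<open>k\<close>-Lucas sequence belongs to
  \<open>S\<^sup>2 - k S - 1\<close>, so its \<open>r\<close>-th transform \<open>b\<close> satisfies
  \<open>b (n + 2) = P * b (n + 1) - Q * b n\<close> with \<open>P = k + 2 r\<close> and \<open>Q = r\<^sup>2 + k r - 1\<close>, and it
  starts with \<open>b 0 = 2\<close> and \<open>b 1 = P\<close>.

  Partial sums of such a sequence telescope: \<open>(1 - P + Q) * b (n + 1)\<close> is the increment of
  \<open>Q * b n - b (n + 1)\<close>.  The denominator of the claimed fraction is
  \<open>1 - P + Q\<close>, the value of the characteristic polynomial at 1.  It is nonzero because \<open>k \<ge> 1\<close>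
  and \<open>r \<ge> 1\<close>.
\<close>

lemma binomial_transform_0: "binomial_transform x 0 = x 0"
  by (simp add: binomial_transform_def)

text \<open>Pascal's rule, read as: the transform intertwines the shift with the forward difference.\<close>

lemma binomial_transform_Suc:
  "binomial_transform x (Suc n) = binomial_transform x n + binomial_transform (\<lambda>i. x (Suc i)) n"
proof -
  have "binomial_transform x (Suc n)
      = x 0 + (\<Sum>i\<le>n. int (Suc n choose Suc i) * x (Suc i))"
    unfolding binomial_transform_def atLeast0AtMost by (subst sum.atMost_Suc_shift) simp
  also have "\<dots> = (x 0 + (\<Sum>i\<le>n. int (n choose Suc i) * x (Suc i)))
      + (\<Sum>i\<le>n. int (n choose i) * x (Suc i))"
    by (simp add: algebra_simps sum.distrib)
  also have "x 0 + (\<Sum>i\<le>n. int (n choose Suc i) * x (Suc i))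
      = (\<Sum>i\<le>Suc n. int (n choose i) * x i)"
    by (subst sum.atMost_Suc_shift) simp
  \<comment> \<open>The top term vanishes, since \<open>n choose (n + 1) = 0\<close>.\<close>
  also have "\<dots> = (\<Sum>i\<le>n. int (n choose i) * x i)"
    by simp
  finally show ?thesis
    by (simp add: binomial_transform_def atLeast0AtMost)
qed

lemma binomial_transform_linear:
  "binomial_transform (\<lambda>i. p * x i - q * y i) n
    = p * binomial_transform x n - q * binomial_transform y n"
  unfolding binomial_transform_def
  by (simp add: sum_distrib_left sum_subtractf [symmetric] algebra_simps)

text \<open>
  The new coefficients are those of the characteristic polynomial with its argument lowered by 1,
  so that both roots increase by 1.
\<close>

lemma binomial_transform_recurrence:
  assumes "\<And>n. x (Suc (Suc n)) = p * x (Suc n) - q * x n"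
  shows "binomial_transform x (Suc (Suc n))
    = (p + 2) * binomial_transform x (Suc n) - (q + p + 1) * binomial_transform x n"
proof -
  let ?T = "\<lambda>y. binomial_transform y n"
  have "?T (\<lambda>i. x (Suc (Suc i))) = p * ?T (\<lambda>i. x (Suc i)) - q * ?T x"
    by (simp add: assms binomial_transform_linear)
  then show ?thesis
    by (simp add: binomial_transform_Suc algebra_simps)
qed

lemma iter_binomial_lucas_Suc:
  "iter_binomial_lucas k (Suc r) = binomial_transform (iter_binomial_lucas k r)"
  by (simp add: iter_binomial_lucas_def)

lemma iter_binomial_lucas_at_0: "iter_binomial_lucas k r 0 = 2"
  by (induction r) (simp_all add: iter_binomial_lucas_def binomial_transform_0)

lemma iter_binomial_lucas_at_1: "iter_binomial_lucas k r (Suc 0) = k + 2 * int r"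
proof (induction r)
  case 0
  show ?case by (simp add: iter_binomial_lucas_def)
next
  case (Suc r)
  then show ?case
    by (simp add: iter_binomial_lucas_Suc binomial_transform_Suc binomial_transform_0
        iter_binomial_lucas_at_0)
qed

lemma iter_binomial_lucas_recurrence:
  "iter_binomial_lucas k r (Suc (Suc n))
    = (k + 2 * int r) * iter_binomial_lucas k r (Suc n)
      - ((int r)\<^sup>2 + k * int r - 1) * iter_binomial_lucas k r n"
proof (induction r arbitrary: n)
  case 0
  show ?case by (simp add: iter_binomial_lucas_def)
next
  case (Suc r)
  have "iter_binomial_lucas k (Suc r) (Suc (Suc n))
    = (k + 2 * int r + 2) * iter_binomial_lucas k (Suc r) (Suc n)
      - ((int r)\<^sup>2 + k * int r - 1 + (k + 2 * int r) + 1) * iter_binomial_lucas k (Suc r) n"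
    unfolding iter_binomial_lucas_Suc by (rule binomial_transform_recurrence) (rule Suc.IH)
  then show ?case
    by (simp add: algebra_simps power2_eq_square)
qed

text \<open>
  Summing the recurrence gives the closed form without division; the boundary term is
  \<open>b 1 - Q * b 0 + (1 - P + Q) * b 0 = b 1 + (1 - P) * b 0\<close>.
\<close>

lemma sum_second_order_recurrence:
  fixes b :: "nat \<Rightarrow> 'a::comm_ring_1"
  assumes "\<And>n. b (Suc (Suc n)) = P * b (Suc n) - Q * b n"
  shows "(1 - P + Q) * (\<Sum>i\<le>n. b i) = Q * b n - b (Suc n) + b 1 + (1 - P) * b 0"
  by (induction n) (simp_all add: assms algebra_simps)

text \<open>
  The expression is \<open>(r - 1)\<^sup>2 + k (r - 1) - 1\<close>, which is \<open>-1\<close> for \<open>r = 1\<close> and at least \<open>k\<close> for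
  \<open>r \<ge> 2\<close>.
\<close>

lemma lucas_denominator_nonzero:
  fixes k r :: int
  assumes "k \<ge> 1" and "r \<ge> 1"
  shows "r\<^sup>2 + k * r - k - 2 * r \<noteq> 0"
proof (cases "r = 1")
  case True
  then show ?thesis by simp
next
  case False
  with assms have "r \<ge> 2" by simp
  then have "r * (r - 2) \<ge> 0" and "k * (r - 1) > 0"
    using assms by simp_all
  moreover have "r\<^sup>2 + k * r - k - 2 * r = r * (r - 2) + k * (r - 1)"
    by (simp add: algebra_simps power2_eq_square)
  ultimately show ?thesis by linarith
qed

theorem theorem2p2:
  fixes k :: int and r n :: nat
  assumes "k \<ge> 1" and "r \<ge> 1" and "n \<ge> 1"
  shows "(\<Sum>i=0..n-1. rat_of_int (iter_binomial_lucas k r i)) =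
    (((of_nat r)^2 + of_int k * of_nat r - 1) * of_int (iter_binomial_lucas k r (n-1))
       - of_int (iter_binomial_lucas k r n) - of_int k - 2 * of_nat r + 2)
    / ((of_nat r)^2 + of_int k * of_nat r - of_int k - 2 * of_nat r)"
proof -
  let ?b = "iter_binomial_lucas k r"
  let ?Q = "(int r)\<^sup>2 + k * int r - 1"
  let ?D = "(int r)\<^sup>2 + k * int r - k - 2 * int r"
  obtain m where n: "n = Suc m"
    using assms(3) by (cases n) auto
  have "?D * (\<Sum>i\<le>m. ?b i) = ?Q * ?b m - ?b (Suc m) - k - 2 * int r + 2"
    using sum_second_order_recurrence [of ?b, OF iter_binomial_lucas_recurrence, of m]
    by (simp add: iter_binomial_lucas_at_0 iter_binomial_lucas_at_1 algebra_simps)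
  then have "rat_of_int (?D * (\<Sum>i\<le>m. ?b i))
      = rat_of_int (?Q * ?b m - ?b (Suc m) - k - 2 * int r + 2)"
    by (rule arg_cong)
  moreover have "rat_of_int ?D \<noteq> 0"
    using lucas_denominator_nonzero [of k "int r"] assms by (simp only: of_int_eq_0_iff) simp
  ultimately show ?thesis
    by (simp add: n atLeast0AtMost nonzero_eq_divide_eq mult.commute)
qed

end
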